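(* Let $\mathbb{F}$ be a field. Each matrix of $\widetilde{\mathcal{C}}$ is PB-companion.
   Context: $\mathbb{F}$ is a field and $x_1,\ldots,x_n$ are variables (independent indeterminates). $\mathbb{F}_n[\lambda]$ is the $(n+1)$-dimensional vector space of polynomials in $\lambda$ over $\mathbb{F}$ of degree at most $n$. A matrix $A$ of order $n$ is PB-companion (companion with respect to a polynomial basis) if: $n^2-n$ of its entries are constants of $\mathbb{F}$; the $n$ remaining entries are the variables $x_1,\ldots,x_n$ (each appearing once); and $\det(\lambda I_n-A)=p_n(\lambda)-x_1p_{n-1}(\lambda)-\cdots-x_{n-1}p_1(\lambda)-x_np_0(\lambda)$ where $\{p_n(\lambda),\ldots,p_1(\lambda),p_0(\lambda)\}$ is a basis of $\mathbb{F}_n[\lambda]$. A square matrix is unit lower Hessenberg (ULH) if all superdiagonal entries equal $1$ and all entries above the superdiagonal are $0$. For integers $i_1,\ldots,i_n$ with $k\le i_k\le n$ and $i_k-k+1\le i_1\le i_k$ for all $k=1,\ldots,n$, let $C_{i_1,\ldots,i_n}$ be the ULH matrix of order $n$ whose $(i_k,i_k-k+1)$ entry is $x_k$ for $k=1,\ldots,n$ and all of whose other entries on or below the main diagonal are $0$. $\mathcal{C}$ is the set of all such matrices (of any order $n\ge1$). A ULH superpattern of a ULH matrix $M$ is a matrix obtained from $M$ by changing some (possibly none) of the zero entries of $M$ on or below the main diagonal to nonzero constants of $\mathbb{F}$. $\widetilde{\mathcal{C}}$ is the set of all ULH superpatterns of all matrices of $\mathcal{C}$. *)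

theory Defs
  imports
    "HOL-Library.Poly_Mapping"
    "Jordan_Normal_Form.Char_Poly"
begin

text \<open>
  A monomial is its finitely supported exponent function, so the type below is the polynomial
  ring over \<open>'a\<close> in the indeterminates \<open>x\<^sub>0, x\<^sub>1, x\<^sub>2, \<dots>\<close>.
  A matrix of order \<open>n\<close> uses \<open>x\<^sub>1, \<dots>, x\<^sub>n\<close> only.
\<close>

type_synonym 'a mpolynomial = "(nat \<Rightarrow>\<^sub>0 nat) \<Rightarrow>\<^sub>0 'a"

definition Const :: "'a \<Rightarrow> 'a::zero mpolynomial" where
  "Const c = Poly_Mapping.single 0 c"

definition Var :: "nat \<Rightarrow> 'a::zero_neq_one mpolynomial" where
  "Var k = Poly_Mapping.single (Poly_Mapping.single k 1) 1"

lemma Const_0 [simp]: "Const 0 = 0"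
  by (simp add: Const_def)

lemma Const_1 [simp]: "Const 1 = 1"
  by (simp add: Const_def)

lemma Var_neq_Const: "Var k \<noteq> Const c"
proof
  assume eq: "Var k = Const c"
  have "Poly_Mapping.single k (1::nat) \<in> Poly_Mapping.keys (Const c)"
    by (simp add: eq [symmetric] Var_def)
  moreover have "Poly_Mapping.keys (Const c) \<subseteq> {0}"
    by (simp add: Const_def)
  ultimately have "Poly_Mapping.single k (1::nat) = 0"
    by blast
  then show False
    by (metis lookup_single_eq lookup_zero zero_neq_one)
qed

lemma Var_inject: "Var j = (Var k :: 'a::zero_neq_one mpolynomial) \<longleftrightarrow> j = k"
proof
  assume "Var j = (Var k :: 'a mpolynomial)"
  then have "Poly_Mapping.keys (Var j :: 'a mpolynomial) = Poly_Mapping.keys (Var k :: 'a mpolynomial)"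
    by simp
  then have "Poly_Mapping.keys (Poly_Mapping.single j (1::nat)) = Poly_Mapping.keys (Poly_Mapping.single k (1::nat))"
    by (simp add: Var_def)
  then show "j = k"
    by simp
qed simp

lemma vector_space_smult: "vector_space (Polynomial.smult :: 'a::field \<Rightarrow> 'a poly \<Rightarrow> 'a poly)"
  by unfold_locales (simp_all add: smult_add_right smult_add_left)

definition poly_basis :: "nat \<Rightarrow> (nat \<Rightarrow> 'a::field poly) \<Rightarrow> bool" where
  "poly_basis n p \<longleftrightarrow>
     inj_on p {0..n} \<and>
     \<not> module.dependent Polynomial.smult (p ` {0..n}) \<and>
     module.span Polynomial.smult (p ` {0..n}) = {q. degree q \<le> n}"

text \<open>
  \<^const>\<open>char_poly\<close> is \<open>det (\<lambda>I - A)\<close>, here over the polynomials in \<open>\<lambda>\<close> with coefficients in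
  the multivariate ring.  Every entry is a constant or one of \<open>x\<^sub>1, \<dots>, x\<^sub>n\<close>, and each of these
  variables occurs exactly once, which leaves exactly \<open>n\<^sup>2 - n\<close> constant entries.
\<close>

definition PB_companion :: "nat \<Rightarrow> 'a::field mpolynomial mat \<Rightarrow> bool" where
  "PB_companion n A \<longleftrightarrow>
     A \<in> carrier_mat n n \<and>
     (\<forall>r<n. \<forall>s<n. (\<exists>c. A $$ (r, s) = Const c) \<or> (\<exists>k\<in>{1..n}. A $$ (r, s) = Var k)) \<and>
     (\<forall>k\<in>{1..n}. \<exists>!(r, s). r < n \<and> s < n \<and> A $$ (r, s) = Var k) \<and>
     (\<exists>p. poly_basis n p \<and>
        char_poly A =
          map_poly Const (p n) - (\<Sum>k = 1..n. Polynomial.smult (Var k) (map_poly Const (p (n - k)))))"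

definition ULH :: "nat \<Rightarrow> 'a::{zero,one} mat \<Rightarrow> bool" where
  "ULH n A \<longleftrightarrow>
     A \<in> carrier_mat n n \<and>
     (\<forall>r<n. \<forall>s<n. (s = r + 1 \<longrightarrow> A $$ (r, s) = 1) \<and> (s > r + 1 \<longrightarrow> A $$ (r, s) = 0))"

definition admissible :: "nat \<Rightarrow> (nat \<Rightarrow> nat) \<Rightarrow> bool" where
  "admissible n i \<longleftrightarrow>
     (\<forall>k\<in>{1..n}. k \<le> i k \<and> i k \<le> n \<and> i k - k + 1 \<le> i 1 \<and> i 1 \<le> i k)"

text \<open>
  Matrix indices start at 0, so the position with 1-based coordinates \<open>(a, b)\<close> is \<open>(a - 1, b - 1)\<close>.
  For \<open>b \<le> a\<close> the equation \<open>(a, b) = (i\<^sub>k, i\<^sub>k - k + 1)\<close> forces \<open>k = a - b + 1\<close>, so it amounts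
  to \<open>a = i\<^sub>k\<close> for this \<open>k\<close>.
\<close>

definition C_mat :: "nat \<Rightarrow> (nat \<Rightarrow> nat) \<Rightarrow> 'a::field mpolynomial mat" where
  "C_mat n i = mat n n (\<lambda>(r, s).
     if s > r + 1 then 0
     else if s = r + 1 then 1
     else let k = r - s + 1 in if i k = r + 1 then Var k else 0)"

lemma ULH_C_mat: "ULH n (C_mat n i)"
  by (simp add: ULH_def C_mat_def)

lemma C_mat_Var:
  assumes "admissible n i" "k \<in> {1..n}"
  shows "C_mat n i $$ (i k - 1, i k - k) = Var k"
proof -
  have "1 \<le> k" "k \<le> i k" "i k \<le> n"
    using assms by (auto simp: admissible_def)
  moreover from this have "i k - Suc 0 - (i k - k) + 1 = k"
    by simp
  ultimately show ?thesis
    by (auto simp: C_mat_def Let_def)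
qed

lemma C_mat_zero:
  assumes "r < n" "s \<le> r" "\<And>k. k \<in> {1..n} \<Longrightarrow> (r, s) \<noteq> (i k - 1, i k - k)"
  shows "C_mat n i $$ (r, s) = 0"
proof -
  have "r - s + 1 \<in> {1..n}"
    using assms(1,2) by auto
  from assms(3)[OF this] show ?thesis
    using assms(1,2) by (auto simp: C_mat_def Let_def)
qed

definition C_set :: "'a::field mpolynomial mat set" where
  "C_set = {C_mat n i | n i. 1 \<le> n \<and> admissible n i}"

definition ULH_superpattern :: "'a::field mpolynomial mat \<Rightarrow> 'a mpolynomial mat \<Rightarrow> bool" where
  "ULH_superpattern M A \<longleftrightarrow>
     (\<exists>n. ULH n M \<and> A \<in> carrier_mat n n \<and>
       (\<forall>r<n. \<forall>s<n. A $$ (r, s) = M $$ (r, s) \<or>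
          (s \<le> r \<and> M $$ (r, s) = 0 \<and> (\<exists>c. c \<noteq> 0 \<and> A $$ (r, s) = Const c))))"

definition C_tilde :: "'a::field mpolynomial mat set" where
  "C_tilde = {A. \<exists>M\<in>C_set. ULH_superpattern M A}"

end

theory Submission
  imports Defs
begin

text \<open>
  Let \<open>B = \<lambda>I - A\<close>.  Since \<open>A\<close> is unit lower Hessenberg, \<open>B\<close> has \<open>-1\<close> on the superdiagonal and
  \<open>0\<close> above it, and its determinant is a sum over the ways to cut \<open>{1, \<dots>, n}\<close> into consecutive
  intervals \<open>{s, \<dots>, r}\<close>: each way contributes the product of the entries \<open>B\<^sub>r\<^sub>s\<close> of its intervals
  (the sign of a cycle cancels against the entries \<open>-1\<close> that the cycle uses).  Now fix \<open>c\<close>.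
  Exactly one interval of each cutting contains \<open>c\<close>, so that
    \<open>det B = (\<Sum>s \<le> c \<le> r. B\<^sub>r\<^sub>s L\<^sub>s\<^sub>-\<^sub>1 T\<^sub>r\<^sub>+\<^sub>1)\<close>,
  where \<open>L\<^sub>m\<close> is the determinant of the leading block of order \<open>m\<close> and \<open>T\<^sub>m\<close> that of the trailing
  block that starts at index \<open>m\<close>.  This is \<open>hess_det_split\<close>.

  Take \<open>c = i\<^sub>1\<close>.  By admissibility every variable sits at a position \<open>(r, s)\<close> with \<open>s \<le> c \<le> r\<close>,
  whereas \<open>L\<^sub>s\<^sub>-\<^sub>1\<close> only sees rows above \<open>c\<close> and \<open>T\<^sub>r\<^sub>+\<^sub>1\<close> only columns to the right of \<open>c\<close>.  Hence
  these two are polynomials in \<open>\<lambda>\<close> over the field, the determinant is affine linear in the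
  variables, and the coefficient of \<open>x\<^sub>k\<close> is \<open>-L T\<close> with blocks of orders \<open>i\<^sub>k - k\<close> and \<open>n - i\<^sub>k\<close>
  (\<open>char_poly_linear_in_variables\<close>).  Characteristic polynomials are monic, so \<open>L T\<close> is monic of
  degree \<open>n - k\<close>; with the part free of variables, monic of degree \<open>n\<close>, this gives one polynomial
  of each degree \<open>0, \<dots>, n\<close>, which is a basis (\<open>poly_basis_if_degrees\<close>).  The constants that a
  superpattern adds change these polynomials but not their degrees.
\<close>

section \<open>Hessenberg determinants\<close>

text \<open>
  The determinant of the leading block of order \<open>m\<close> of a lower Hessenberg matrix with \<open>-1\<close> on
  the superdiagonal, expanded by the interval \<open>{s, \<dots>, m}\<close> that contains the last index.  Taking
  the entries as a function rather than a matrix lets one recursion serve blocks of every order,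
  and only entries on or below the diagonal are ever used.
\<close>

fun hess_det :: "(nat \<Rightarrow> nat \<Rightarrow> 'a::comm_ring_1) \<Rightarrow> nat \<Rightarrow> 'a" where
  "hess_det B 0 = 1"
| "hess_det B (Suc m) = (\<Sum>s\<le>m. B m s * hess_det B s)"

text \<open>
  The vector \<open>v\<close> of the leading block determinants solves all rows of \<open>B v = 0\<close> except the last,
  where the product is \<open>hess_det B n\<close>; this is the defining recursion.  As the first entry of \<open>v\<close>
  is \<open>1\<close>, replacing the first column of \<open>B\<close> by \<open>B v\<close> preserves the determinant, and the new
  column leaves only one cofactor, which is triangular with diagonal \<open>-1\<close>.
\<close>

lemma det_eq_hess_det:
  fixes B :: "nat \<Rightarrow> nat \<Rightarrow> 'a::idom"
  assumes super: "\<And>r. Suc r < n \<Longrightarrow> B r (Suc r) = -1"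
    and above: "\<And>r s. Suc r < s \<Longrightarrow> s < n \<Longrightarrow> B r s = 0"
  shows "det (mat n n (\<lambda>(r, s). B r s)) = hess_det B n"
proof (cases n)
  case 0
  then show ?thesis by (simp add: det_def)
next
  case (Suc m)
  define M where "M = mat n n (\<lambda>(r, s). B r s)"
  define V where "V = mat n n (\<lambda>(r, s). if s = 0 then hess_det B r else if r = s then 1 else 0)"
  define W where "W = mat n n (\<lambda>(r, s). if s = 0 then (if r = m then hess_det B n else 0) else B r s)"
  \<comment> \<open>The entry \<open>-1\<close> in column \<open>Suc r\<close> subtracts what the entries up to the diagonal add up to.\<close>
  have row: "(\<Sum>j<n. B r j * hess_det B j) = (if r = m then hess_det B n else 0)" if "r < n" for r
  proof (cases "r = m")
    case True
    then show ?thesis by (simp add: Suc lessThan_Suc_atMost)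
  next
    case False
    then have r: "Suc r < n" using that Suc by simp
    have "(\<Sum>j<n. B r j * hess_det B j) = (\<Sum>j\<le>Suc r. B r j * hess_det B j)"
      by (rule sum.mono_neutral_right) (use r above in auto)
    then show ?thesis using False super[OF r] by simp
  qed
  have "M * V = W"
  proof (rule eq_matI)
    fix r s assume "r < dim_row W" "s < dim_col W"
    then have rs: "r < n" "s < n" by (simp_all add: W_def)
    then have "(M * V) $$ (r, s) = (\<Sum>j<n. B r j * V $$ (j, s))"
      by (auto simp: M_def V_def scalar_prod_def lessThan_atLeast0 intro!: sum.cong)
    also have "\<dots> = W $$ (r, s)"
    proof (cases "s = 0")
      case True
      then show ?thesis using row[OF rs(1)] rs by (simp add: V_def W_def)
    next
      case False
      have "(\<Sum>j<n. B r j * V $$ (j, s)) = (\<Sum>j<n. if j = s then B r j else 0)"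
        by (rule sum.cong) (use rs False in \<open>auto simp: V_def\<close>)
      then show ?thesis using rs False by (simp add: W_def)
    qed
    finally show "(M * V) $$ (r, s) = W $$ (r, s)" .
  qed (simp_all add: M_def V_def W_def)
  moreover have "det V = 1"
  proof -
    have "det V = prod_list (diag_mat V)"
      by (rule det_lower_triangular[where n = n]) (auto simp: V_def)
    also have "diag_mat V = map (\<lambda>_. 1) [0..<n]"
      by (auto simp: diag_mat_def V_def)
    finally show ?thesis by (simp add: map_replicate_const)
  qed
  moreover have "det (M * V) = det M * det V"
    by (rule det_mult[where n = n]) (simp_all add: M_def V_def)
  ultimately have "det M = det W" by simp
  also have "\<dots> = (\<Sum>r<n. W $$ (r, 0) * cofactor W r 0)"
    by (rule laplace_expansion_column) (simp_all add: W_def Suc)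
  also have "\<dots> = (\<Sum>r<n. if r = m then hess_det B n * cofactor W m 0 else 0)"
    by (rule sum.cong) (auto simp: W_def Suc)
  also have "\<dots> = hess_det B n * cofactor W m 0"
    by (simp add: Suc)
  also have "cofactor W m 0 = 1"
  proof -
    let ?D = "mat_delete W m 0"
    have W: "W \<in> carrier_mat (Suc m) (Suc m)" by (simp add: W_def Suc)
    have D: "?D \<in> carrier_mat m m"
      using mat_delete_carrier[OF W] by simp
    have entry: "?D $$ (r, s) = B r (Suc s)" if "r < m" "s < m" for r s
      using that by (simp add: mat_delete_def W_def Suc)
    have "det ?D = prod_list (diag_mat ?D)"
      by (rule det_lower_triangular[OF _ D]) (auto simp: entry above Suc)
    also have "diag_mat ?D = map (\<lambda>_. -1) [0..<m]"
      using D by (auto simp: diag_mat_def entry super Suc)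
    finally show ?thesis
      by (simp add: cofactor_def map_replicate_const flip: power_mult_distrib)
  qed
  finally show ?thesis by (simp add: M_def)
qed

lemma hess_det_cong:
  assumes "\<And>r s. s \<le> r \<Longrightarrow> r < m \<Longrightarrow> B r s = B' r s"
  shows "hess_det B m = hess_det B' m"
  using assms
proof (induction m rule: less_induct)
  case (less m)
  then show ?case
    by (cases m) (auto intro!: sum.cong)
qed

lemma (in comm_ring_hom) hom_hess_det:
  "hom (hess_det B m) = hess_det (\<lambda>r s. hom (B r s)) m"
proof (induction m rule: less_induct)
  case (less m)
  then show ?case
    by (cases m) (auto simp: hom_distribs intro!: sum.cong)
qed

text \<open>
  Only the cutting into singletons reaches degree \<open>m\<close>; in the recursion, the last summand does,
  and all others have degree below \<open>m\<close>.
\<close>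

lemma hess_det_monic:
  fixes B :: "nat \<Rightarrow> nat \<Rightarrow> 'a::idom poly"
  assumes diag: "\<And>r. r < m \<Longrightarrow> degree (B r r) = 1 \<and> monic (B r r)"
    and below: "\<And>r s. s < r \<Longrightarrow> r < m \<Longrightarrow> degree (B r s) = 0"
  shows "degree (hess_det B m) = m \<and> monic (hess_det B m)"
  using assms
proof (induction m rule: less_induct)
  case (less m)
  show ?case
  proof (cases m)
    case 0
    then show ?thesis by simp
  next
    case (Suc l)
    have IH: "degree (hess_det B s) = s" "monic (hess_det B s)" if "s \<le> l" for s
    proof -
      have "degree (hess_det B s) = s \<and> monic (hess_det B s)"
      proof (rule less.IH)
        show "s < m" using that Suc by simp
        show "degree (B r r) = 1 \<and> monic (B r r)" if "r < s" for r
          by (rule less.prems(1)) (use that \<open>s < m\<close> in simp)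
        show "degree (B r t) = 0" if "t < r" "r < s" for r t
          by (rule less.prems(2)) (use that \<open>s < m\<close> in simp_all)
      qed
      then show "degree (hess_det B s) = s" "monic (hess_det B s)" by blast+
    qed
    have Bl: "degree (B l l) = 1" "monic (B l l)"
      using less.prems(1)[of l] by (auto simp: Suc)
    let ?main = "B l l * hess_det B l" and ?rest = "\<Sum>s<l. B l s * hess_det B s"
    have mon: "monic ?main" using Bl IH[of l] by (simp add: lead_coeff_mult)
    have deg: "degree ?main = Suc l"
      using Bl IH[of l] by (subst degree_mult_eq) auto
    have "degree ?rest < Suc l"
    proof (rule degree_sum_less)
      fix s assume "s \<in> {..<l}"
      then have "degree (B l s * hess_det B s) \<le> 0 + s"
        using degree_mult_le[of "B l s" "hess_det B s"] less.prems(2)[of s l] IH[of s]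
        by (simp add: Suc)
      then show "degree (B l s * hess_det B s) < Suc l" using \<open>s \<in> {..<l}\<close> by simp
    qed simp
    then have "degree (?rest + ?main) = degree ?main" "lead_coeff (?rest + ?main) = lead_coeff ?main"
      by (simp_all add: degree_add_eq_right deg coeff_eq_0)
    moreover have "hess_det B m = ?rest + ?main"
      by (simp add: Suc flip: lessThan_Suc_atMost)
    ultimately show ?thesis using mon deg by (simp add: Suc)
  qed
qed

text \<open>
  The determinant of the trailing block with the indices \<open>s, \<dots>, n - 1\<close>.  Reflection in the
  antidiagonal keeps the Hessenberg shape and turns trailing blocks into leading ones, so that the
  facts about \<^const>\<open>hess_det\<close> transfer without a second proof.
\<close>

definition hess_det_trailing :: "(nat \<Rightarrow> nat \<Rightarrow> 'a::comm_ring_1) \<Rightarrow> nat \<Rightarrow> nat \<Rightarrow> 'a" where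
  "hess_det_trailing B n s = hess_det (\<lambda>r t. B (n - Suc t) (n - Suc r)) (n - s)"

lemma hess_det_trailing_top [simp]: "hess_det_trailing B n n = 1"
  by (simp add: hess_det_trailing_def)

lemma hess_det_trailing_rec:
  assumes "s < n"
  shows "hess_det_trailing B n s = (\<Sum>r=s..<n. B r s * hess_det_trailing B n (Suc r))"
proof -
  obtain m where m: "n - s = Suc m" using assms by (metis Suc_diff_Suc)
  have "hess_det_trailing B n s
      = (\<Sum>t\<le>m. B (n - Suc t) s * hess_det (\<lambda>r t. B (n - Suc t) (n - Suc r)) t)"
  proof -
    have "n - Suc m = s" using m assms by linarith
    then show ?thesis by (simp add: hess_det_trailing_def m)
  qed
  also have "\<dots> = (\<Sum>r=s..<n. B r s * hess_det_trailing B n (Suc r))"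
    unfolding hess_det_trailing_def
    by (rule sum.reindex_bij_witness[of _ "\<lambda>r. n - Suc r" "\<lambda>t. n - Suc t"])
       (use m assms in auto)
  finally show ?thesis .
qed

text \<open>
  For \<open>c = n - 1\<close> this is the defining recursion.  The sums for \<open>c\<close> and \<open>Suc c\<close> differ by the terms
  with \<open>r = c\<close>, which add up to the leading determinant of order \<open>Suc c\<close> times the trailing one that
  starts at \<open>Suc c\<close>, and by those with \<open>s = Suc c\<close>, which add up to the same product.
\<close>

lemma hess_det_split:
  assumes "c < n"
  shows "hess_det B n = (\<Sum>s\<le>c. \<Sum>r=c..<n. B r s * hess_det B s * hess_det_trailing B n (Suc r))"
proof -
  define f where "f s r = B r s * hess_det B s * hess_det_trailing B n (Suc r)" for s r
  from assms have "(\<Sum>s\<le>c. \<Sum>r=c..<n. f s r) = hess_det B n"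
  proof (induction rule: strict_inc_induct)
    case (base c)
    then have "{c..<n} = {c}" by auto
    with base show ?case by (auto simp: f_def)
  next
    case (step c)
    have "(\<Sum>s\<le>c. \<Sum>r=c..<n. f s r) = (\<Sum>s\<le>c. f s c) + (\<Sum>s\<le>c. \<Sum>r=Suc c..<n. f s r)"
      using step by (simp add: sum.atLeast_Suc_lessThan sum.distrib)
    also have "(\<Sum>s\<le>c. f s c) = hess_det B (Suc c) * hess_det_trailing B n (Suc c)"
      by (simp add: f_def sum_distrib_right)
    also have "\<dots> = (\<Sum>r=Suc c..<n. f (Suc c) r)"
      using step
      by (simp add: f_def hess_det_trailing_rec[of "Suc c"] sum_distrib_left mult_ac del: hess_det.simps)
    also have "\<dots> + (\<Sum>s\<le>c. \<Sum>r=Suc c..<n. f s r) = (\<Sum>s\<le>Suc c. \<Sum>r=Suc c..<n. f s r)"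
      by (simp add: add.commute)
    finally show ?case using step by simp
  qed
  then show ?thesis by (simp add: f_def)
qed

section \<open>Polynomial bases from degrees\<close>

text \<open>
  Induction on \<open>n\<close>: the new polynomial has too large a degree to be in the span of the old ones, and
  subtracting a multiple of it removes the leading term of any polynomial of degree \<open>n + 1\<close>.
\<close>

lemma poly_basis_if_degrees:
  fixes p :: "nat \<Rightarrow> 'a::field poly"
  assumes nz: "\<And>j. j \<le> n \<Longrightarrow> p j \<noteq> 0" and deg: "\<And>j. j \<le> n \<Longrightarrow> degree (p j) = j"
  shows "poly_basis n p"
  using assms
proof (induction n)
  interpret vs: vector_space "Polynomial.smult :: 'a \<Rightarrow> 'a poly \<Rightarrow> 'a poly"
    by (rule vector_space_smult)
  {
    case 0
    then obtain a where a: "p 0 = [:a:]" "a \<noteq> 0"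
      by (metis degree_eq_zeroE le_refl pCons_0_0)
    have "range (\<lambda>k. Polynomial.smult k [:a:]) = {q. degree q = 0}" (is "?L = ?R")
    proof
      show "?R \<subseteq> ?L"
      proof
        fix q assume "q \<in> ?R"
        then obtain b where "q = [:b:]" by (auto elim: degree_eq_zeroE)
        then have "q = Polynomial.smult (b / a) [:a:]" using a by simp
        then show "q \<in> ?L" by blast
      qed
    qed auto
    with a show ?case by (simp add: poly_basis_def vs.span_singleton)
  next
    case (Suc n)
    then have IH: "inj_on p {0..n}" "\<not> vs.dependent (p ` {0..n})"
        "vs.span (p ` {0..n}) = {q. degree q \<le> n}"
      by (auto simp: poly_basis_def)
    have ins: "p ` {0..Suc n} = insert (p (Suc n)) (p ` {0..n})"
      by (simp add: atLeast0_atMost_Suc)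
    have notin: "p (Suc n) \<notin> vs.span (p ` {0..n})"
      using Suc.prems by (simp add: IH)
    have "vs.span (p ` {0..Suc n}) = {q. degree q \<le> Suc n}"
    proof -
      have "(\<exists>k. degree (q - Polynomial.smult k (p (Suc n))) \<le> n) \<longleftrightarrow> degree q \<le> Suc n" for q
      proof
        assume "\<exists>k. degree (q - Polynomial.smult k (p (Suc n))) \<le> n"
        then obtain k where k: "degree (q - Polynomial.smult k (p (Suc n))) \<le> n" ..
        have "degree (q - Polynomial.smult k (p (Suc n)) + Polynomial.smult k (p (Suc n))) \<le> Suc n"
          by (rule degree_add_le) (use k Suc.prems in auto)
        then show "degree q \<le> Suc n" by simp
      next
        assume q: "degree q \<le> Suc n"
        define k where "k = coeff q (Suc n) / coeff (p (Suc n)) (Suc n)"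
        have "coeff (p (Suc n)) (Suc n) \<noteq> 0"
          using Suc.prems by (metis leading_coeff_0_iff order_refl)
        then have "coeff (q - Polynomial.smult k (p (Suc n))) i = 0" if "i > n" for i
          using that q Suc.prems
          by (cases "i = Suc n") (auto simp: k_def coeff_eq_0)
        then show "\<exists>k. degree (q - Polynomial.smult k (p (Suc n))) \<le> n"
          using degree_le by blast
      qed
      then show ?thesis
        unfolding ins vs.span_insert IH by auto
    qed
    moreover have "inj_on p {0..Suc n}"
      by (rule inj_onI) (metis Suc.prems(2) atLeastAtMost_iff)
    moreover have "\<not> vs.dependent (p ` {0..Suc n})"
      unfolding ins using notin IH by (simp add: vs.independent_insertI)
    ultimately show ?case by (simp add: poly_basis_def)
  }
qed

section \<open>Position of the variables\<close>

interpretation Const_hom: comm_ring_hom "Const :: 'a::field \<Rightarrow> 'a mpolynomial"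
  by unfold_locales (simp_all add: Const_def single_add mult_single)

interpretation Const_poly_hom: map_poly_comm_ring_hom "Const :: 'a::field \<Rightarrow> 'a mpolynomial" ..

text \<open>
  The part of the entry \<open>(r, s)\<close> that is not constant, with indices starting at 0: the variable
  \<open>x\<^sub>k\<close> lies on the diagonal \<open>r - s + 1 = k\<close>, in row \<open>i\<^sub>k - 1\<close>.
\<close>

definition var_part :: "(nat \<Rightarrow> nat) \<Rightarrow> nat \<Rightarrow> nat \<Rightarrow> 'a::field mpolynomial" where
  "var_part i r s = (if i (r - s + 1) = r + 1 then Var (r - s + 1) else 0)"

lemma admissible_bounds:
  assumes "admissible n i" and "k \<in> {1..n}"
  shows "1 \<le> k" "k \<le> i k" "i k \<le> n" "i k - k + 1 \<le> i 1" "i 1 \<le> i k"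
  using assms by (auto simp: admissible_def)

text \<open>
  The inequalities \<open>i\<^sub>k - k + 1 \<le> i\<^sub>1 \<le> i\<^sub>k\<close> place every variable in the lower left block
  whose upper right corner is the diagonal entry \<open>(i\<^sub>1, i\<^sub>1)\<close>.
\<close>

lemma var_part_support:
  assumes adm: "admissible n i" and "s \<le> r" "r < n" "(var_part i r s :: 'a::field mpolynomial) \<noteq> 0"
  shows "i 1 \<le> r + 1" and "s < i 1"
proof -
  have "r - s + 1 \<in> {1..n}" "i (r - s + 1) = r + 1"
    using assms by (auto simp: var_part_def split: if_splits)
  then show "i 1 \<le> r + 1" "s < i 1"
    using adm \<open>s \<le> r\<close> unfolding admissible_def by force+
qed

text \<open>
  A superpattern changes zero entries only, so a constant and a variable never meet in one entry;
  the last property records this.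
\<close>

lemma C_tilde_entries:
  fixes A :: "'a::field mpolynomial mat"
  assumes "A \<in> C_tilde"
  obtains n i d where "1 \<le> n" "admissible n i" "A \<in> carrier_mat n n"
    "\<forall>r. Suc r < n \<longrightarrow> A $$ (r, Suc r) = 1"
    "\<forall>r s. Suc r < s \<longrightarrow> s < n \<longrightarrow> A $$ (r, s) = 0"
    "\<forall>r s. s \<le> r \<longrightarrow> r < n \<longrightarrow> A $$ (r, s) = Const (d r s) + var_part i r s"
    "\<forall>r s. i (r - s + 1) = r + 1 \<longrightarrow> d r s = 0"
proof -
  obtain n i where n: "1 \<le> n" and adm: "admissible n i"
    and super: "ULH_superpattern (C_mat n i) A"
    using assms by (auto simp: C_tilde_def C_set_def)
  define M :: "'a mpolynomial mat" where "M = C_mat n i"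
  obtain l where l: "M \<in> carrier_mat l l" "A \<in> carrier_mat l l"
    and patt: "\<forall>r<l. \<forall>s<l. A $$ (r, s) = M $$ (r, s) \<or>
      (s \<le> r \<and> M $$ (r, s) = 0 \<and> (\<exists>c. c \<noteq> 0 \<and> A $$ (r, s) = Const c))"
    using super unfolding ULH_superpattern_def ULH_def M_def[symmetric] by (elim exE conjE) (rule that)
  have "l = n"
    using carrier_matD(1)[OF l(1)] unfolding M_def C_mat_def dim_row_mat by (rule sym)
  have upper: "A $$ (r, s) = M $$ (r, s)" if "r < s" "s < n" for r s
  proof -
    have "r < l" "s < l" "\<not> s \<le> r" using that \<open>l = n\<close> by auto
    then show ?thesis using patt by blast
  qed
  have M_lower: "M $$ (r, s) = var_part i r s" if "s \<le> r" "r < n" for r s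
    using that by (simp add: M_def C_mat_def var_part_def Let_def)
  have Var_nz: "Var k \<noteq> (0 :: 'a mpolynomial)" for k
    using Var_neq_Const[of k "0::'a"] by simp
  define splits where "splits r s c \<longleftrightarrow> (s \<le> r \<longrightarrow> r < n \<longrightarrow> A $$ (r, s) = Const c + var_part i r s)
      \<and> (i (r - s + 1) = r + 1 \<longrightarrow> c = 0)" for r s c
  have "\<exists>c. splits r s c" for r s
  proof (cases "s \<le> r \<and> r < n \<and> A $$ (r, s) \<noteq> var_part i r s")
    case True
    then have "s < l" "r < l" using \<open>l = n\<close> by auto
    with True M_lower patt obtain c where "var_part i r s = (0 :: 'a mpolynomial)" "A $$ (r, s) = Const c"
      by metis
    then show ?thesis using Var_nz by (auto simp: splits_def var_part_def split: if_splits)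
  next
    case False
    then show ?thesis by (intro exI[of _ 0]) (auto simp: splits_def)
  qed
  then obtain d where d: "\<And>r s. splits r s (d r s)"
    by metis
  show thesis
  proof (rule that[OF n adm, of d])
    show "A \<in> carrier_mat n n" using l(2) \<open>l = n\<close> by simp
    show "\<forall>r. Suc r < n \<longrightarrow> A $$ (r, Suc r) = 1"
      using upper by (simp add: M_def C_mat_def)
    show "\<forall>r s. Suc r < s \<longrightarrow> s < n \<longrightarrow> A $$ (r, s) = 0"
      using upper by (simp add: M_def C_mat_def)
  qed (use d in \<open>simp_all add: splits_def\<close>)
qed

section \<open>The characteristic polynomial\<close>

text \<open>
  Here \<open>q\<close> holds the lower entries of \<open>\<lambda>I - A\<close> with all variables set to \<open>0\<close>.  In the expansion
  around the index \<open>i\<^sub>1\<close> (\<open>i\<^sub>1 - 1\<close> when counted from 0) the block determinants agree for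
  \<open>\<lambda>I - A\<close> and \<open>q\<close>, because their blocks miss the variables; collecting the variable-free terms
  reverses the expansion for \<open>q\<close>.
\<close>

lemma char_poly_linear_in_variables:
  fixes A :: "'a::field mpolynomial mat" and d :: "nat \<Rightarrow> nat \<Rightarrow> 'a"
  defines "q \<equiv> \<lambda>r s. if r = s then [:- d r s, 1:] else [:- d r s:]"
  assumes n: "1 \<le> n" and adm: "admissible n i" and A: "A \<in> carrier_mat n n"
    and A_super: "\<And>r. Suc r < n \<Longrightarrow> A $$ (r, Suc r) = 1"
    and A_above: "\<And>r s. Suc r < s \<Longrightarrow> s < n \<Longrightarrow> A $$ (r, s) = 0"
    and A_lower: "\<And>r s. s \<le> r \<Longrightarrow> r < n \<Longrightarrow> A $$ (r, s) = Const (d r s) + var_part i r s"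
  shows "char_poly A = map_poly Const (hess_det q n) - (\<Sum>k = 1..n. Polynomial.smult (Var k)
           (map_poly Const (hess_det q (i k - k) * hess_det_trailing q n (i k))))"
proof -
  note adm' = admissible_bounds[OF adm]
  define c where "c = i 1 - 1"
  have c: "c < n" "i 1 = Suc c" using adm'[of 1] n by (auto simp: c_def)
  define B where "B r s = char_poly_matrix A $$ (r, s)" for r s
  have B: "B r s = map_poly Const (q r s) - [:var_part i r s:]" if "s \<le> r" "r < n" for r s
    using that A A_lower[OF that]
    by (auto simp: B_def char_poly_matrix_def q_def Const_hom.map_poly_pCons_hom Const_hom.hom_uminus)
  have "char_poly A = det (mat n n (\<lambda>(r, s). B r s))"
    using A unfolding char_poly_def B_def
    by (intro arg_cong[of _ _ det] eq_matI) (auto simp: char_poly_matrix_def)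
  also have "\<dots> = hess_det B n"
    using A by (intro det_eq_hess_det)
      (auto simp: B_def char_poly_matrix_def A_super A_above one_pCons)
  also have "\<dots> = (\<Sum>s\<le>c. \<Sum>r=c..<n. B r s * hess_det B s * hess_det_trailing B n (Suc r))"
    by (rule hess_det_split[OF c(1)])
  also have "\<dots> = (\<Sum>s\<le>c. \<Sum>r=c..<n. (map_poly Const (q r s) - [:var_part i r s:])
      * map_poly Const (hess_det q s) * map_poly Const (hess_det_trailing q n (Suc r)))"
  proof (intro sum.cong refl)
    fix s r assume sr: "s \<in> {..c}" "r \<in> {c..<n}"
    \<comment> \<open>Row above \<open>c\<close> or column to the right of \<open>c\<close>: no variable can occur.\<close>
    have outside: "B r' s' = map_poly Const (q r' s')"
      if "s' \<le> r'" "r' < n" "r' < c \<or> c < s'" for r' s'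
      using B[OF that(1,2)] var_part_support[OF adm that(1,2), where ?'a = 'a] that(3) c by fastforce
    have "hess_det B s = map_poly Const (hess_det q s)"
      unfolding Const_poly_hom.hom_hess_det
      by (rule hess_det_cong) (use sr c in \<open>auto intro!: outside\<close>)
    moreover have "hess_det_trailing B n (Suc r) = map_poly Const (hess_det_trailing q n (Suc r))"
      unfolding hess_det_trailing_def Const_poly_hom.hom_hess_det
      by (rule hess_det_cong) (use sr c in \<open>auto intro!: outside\<close>)
    ultimately show "B r s * hess_det B s * hess_det_trailing B n (Suc r) =
        (map_poly Const (q r s) - [:var_part i r s:]) * map_poly Const (hess_det q s)
          * map_poly Const (hess_det_trailing q n (Suc r))"
      using sr by (simp add: B)
  qed
  also have "\<dots> = map_poly Const (\<Sum>s\<le>c. \<Sum>r=c..<n. q r s * hess_det q s * hess_det_trailing q n (Suc r))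
      - (\<Sum>s\<le>c. \<Sum>r=c..<n. Polynomial.smult (var_part i r s)
           (map_poly Const (hess_det q s * hess_det_trailing q n (Suc r))))"
    by (simp add: Const_poly_hom.hom_sum Const_poly_hom.hom_mult left_diff_distrib sum_subtractf)
  also have "(\<Sum>s\<le>c. \<Sum>r=c..<n. q r s * hess_det q s * hess_det_trailing q n (Suc r)) = hess_det q n"
    by (rule hess_det_split[OF c(1), symmetric])
  also have "(\<Sum>s\<le>c. \<Sum>r=c..<n. Polynomial.smult (var_part i r s)
           (map_poly Const (hess_det q s * hess_det_trailing q n (Suc r))))
     = (\<Sum>k = 1..n. Polynomial.smult (Var k)
           (map_poly Const (hess_det q (i k - k) * hess_det_trailing q n (i k))))"
  proof -
    let ?g = "\<lambda>(s, r). Polynomial.smult (var_part i r s)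
           (map_poly Const (hess_det q s * hess_det_trailing q n (Suc r)))"
    let ?S = "{(s, r). s \<le> c \<and> c \<le> r \<and> r < n \<and> i (r - s + 1) = r + 1}"
    have "sum ?g ({..c} \<times> {c..<n}) = sum ?g ?S"
      by (rule sum.mono_neutral_right) (auto simp: var_part_def split: if_splits)
    also have "\<dots> = (\<Sum>k = 1..n. Polynomial.smult (Var k)
           (map_poly Const (hess_det q (i k - k) * hess_det_trailing q n (i k))))"
    proof (rule sum.reindex_bij_witness[of _ "\<lambda>k. (i k - k, i k - 1)" "\<lambda>(s, r). r - s + 1"])
      fix k assume k: "k \<in> {1..n}"
      have "i k - 1 - (i k - k) + 1 = k" using adm'[OF k] by linarith
      then show "(case (i k - k, i k - 1) of (s, r) \<Rightarrow> r - s + 1) = k"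
        "(i k - k, i k - 1) \<in> ?S"
        using adm'[OF k] c by auto
    qed (auto simp: var_part_def)
    finally show ?thesis by (simp add: sum.cartesian_product)
  qed
  finally show ?thesis .
qed

theorem theorem13:
  fixes A :: "'a::field mpolynomial mat"
  assumes "A \<in> C_tilde"
  shows "PB_companion (dim_row A) A"
proof -
  from assms obtain n i d where n: "1 \<le> n" and adm: "admissible n i" and A: "A \<in> carrier_mat n n"
    and A_super: "\<forall>r. Suc r < n \<longrightarrow> A $$ (r, Suc r) = 1"
    and A_above: "\<forall>r s. Suc r < s \<longrightarrow> s < n \<longrightarrow> A $$ (r, s) = 0"
    and A_lower: "\<forall>r s. s \<le> r \<longrightarrow> r < n \<longrightarrow> A $$ (r, s) = Const (d r s) + var_part i r s"
    and d: "\<forall>r s. i (r - s + 1) = r + 1 \<longrightarrow> d r s = 0"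
    by (rule C_tilde_entries)
  note adm' = admissible_bounds[OF adm]
  have entry: "(s \<le> r \<and> i (r - s + 1) = r + 1 \<and> A $$ (r, s) = Var (r - s + 1)) \<or>
      (\<not> (s \<le> r \<and> i (r - s + 1) = r + 1) \<and> (\<exists>c. A $$ (r, s) = Const c))"
    if "r < n" "s < n" for r s
  proof -
    consider "s \<le> r" | "s = Suc r" | "Suc r < s" by linarith
    then show ?thesis
    proof cases
      case 1
      then show ?thesis using A_lower d 1 that(1) by (auto simp: var_part_def)
    next
      case 2
      then have "A $$ (r, s) = Const 1" using A_super that by simp
      moreover have "\<not> s \<le> r" using 2 by simp
      ultimately show ?thesis by blast
    next
      case 3
      then have "A $$ (r, s) = Const 0" using A_above that by simp
      moreover have "\<not> s \<le> r" using 3 by simp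
      ultimately show ?thesis by blast
    qed
  qed
  have entries: "(\<exists>c. A $$ (r, s) = Const c) \<or> (\<exists>k\<in>{1..n}. A $$ (r, s) = Var k)"
    if "r < n" "s < n" for r s
  proof -
    have "r - s + 1 \<in> {1..n}" using that by auto
    with entry[OF that] show ?thesis by blast
  qed
  have Var_at: "A $$ (r, s) = Var k \<longleftrightarrow> s \<le> r \<and> k = r - s + 1 \<and> i k = r + 1"
    if "r < n" "s < n" for r s k
    using entry[OF that] Var_neq_Const[where ?'a = 'a] by (metis Var_inject)
  have unique: "\<exists>!(r, s). r < n \<and> s < n \<and> A $$ (r, s) = Var k" if k: "k \<in> {1..n}" for k
  proof (rule ex1I[of _ "(i k - 1, i k - k)"])
    have "i k - 1 < n" "i k - k < n" "i k - k \<le> i k - 1" "k = i k - 1 - (i k - k) + 1"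
        "i k = i k - 1 + 1"
      using adm'[OF k] by linarith+
    then show "case (i k - 1, i k - k) of (r, s) \<Rightarrow> r < n \<and> s < n \<and> A $$ (r, s) = Var k"
      unfolding prod.case by (metis Var_at)
    show "x = (i k - 1, i k - k)" if "case x of (r, s) \<Rightarrow> r < n \<and> s < n \<and> A $$ (r, s) = Var k" for x
      using that by (auto simp: Var_at)
  qed
  define q where "q = (\<lambda>r s. if r = s then [:- d r s, 1:] else [:- d r s:])"
  \<comment> \<open>The coefficient of \<open>x\<^sub>k\<close>, for \<open>k = n - j\<close>, is meaningless for \<open>k = 0\<close>, hence the case split.\<close>
  define p where "p j = (if j = n then hess_det q n
     else hess_det q (i (n - j) - (n - j)) * hess_det_trailing q n (i (n - j)))" for j
  have lead: "degree (hess_det q m) = m \<and> monic (hess_det q m)" for m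
    by (rule hess_det_monic) (auto simp: q_def)
  have trail: "degree (hess_det_trailing q n m) = n - m \<and> monic (hess_det_trailing q n m)" for m
    unfolding hess_det_trailing_def by (rule hess_det_monic) (auto simp: q_def)
  have nz: "hess_det q m \<noteq> 0" "hess_det_trailing q n m \<noteq> 0" for m
    using lead[of m] trail[of m] by auto
  have "poly_basis n p"
  proof (rule poly_basis_if_degrees)
    fix j assume j: "j \<le> n"
    show "p j \<noteq> 0"
      using nz by (simp add: p_def)
    show "degree (p j) = j"
    proof (cases "j = n")
      case False
      then have k: "n - j \<in> {1..n}" using j by auto
      have "degree (p j) = (i (n - j) - (n - j)) + (n - i (n - j))"
        using False lead trail nz by (simp add: p_def degree_mult_eq)
      then show ?thesis using adm'[OF k] j by linarith
    qed (simp add: p_def lead)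
  qed
  moreover have "char_poly A =
          map_poly Const (p n) - (\<Sum>k = 1..n. Polynomial.smult (Var k) (map_poly Const (p (n - k))))"
    using char_poly_linear_in_variables[OF n adm A A_super[rule_format] A_above[rule_format]
        A_lower[rule_format], folded q_def]
    by (auto simp: p_def intro!: sum.cong)
  ultimately show ?thesis
    using A entries unique unfolding PB_companion_def by auto
qed

end
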